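(* Let $j\in\{1,2\}$, let $X_j$ be a set of admissible data for Problem $j$ which, with the metric $d_j$, is a Polish space, and let $\mathcal S_j:X_j\to\Xi$ be the solution operator of Problem $j$. Let $C,\tilde C>0$ be the constants of the Lipschitz estimate $$\|\mathcal S_j(\xi)-\mathcal S_j(\tilde\xi)\|_{L^2((0,T);H^1(D))}\le Ce^{\tilde CT/2}\,d_j(\xi,\tilde\xi)\qquad\text{for all }\xi,\tilde\xi\in X_j .$$ Let $\Phi:\Xi\to\mathbb{R}$ (the quantity of interest) be Lipschitz continuous with constant $L_\Phi$ with respect to the norm of $L^2((0,T);H^1(D))$. Let $P$ and $\tilde P$ be Borel probability measures on $(X_j,d_j)$ and let $r\ge1$. Then $$\big|\mathbb{E}_P\Phi(\mathcal S_j)-\mathbb{E}_{\tilde P}\Phi(\mathcal S_j)\big|\le L_\Phi\,C\,e^{\tilde CT/2}\,d_r(P,\tilde P),$$ where $d_r(P,\tilde P)$ is the Wasserstein distance of order $r$ built on the metric $d_j$.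
   Context: Let $D\subset\mathbb{R}^N$, $N\in\{1,2,3\}$, be a bounded domain with Lipschitz boundary and outward normal $n$, and let $T>0$. Let $f\in W^{1,\infty}(\mathbb{R})$ with $f(0)=f(1)=0$ and $f\ge0$ on $(0,1)$; let $g\in W^{1,\infty}(\mathbb{R})$ be decreasing with $g(0)=1$, $g(1)=0$; let $\Gamma_{\mathrm{in}},\Gamma_{\mathrm{out}}\subset\partial D$ be open and disjoint, with $\Gamma_{\mathrm{out}}\neq\emptyset$. Let $\Xi$ be the space of $u\in L^2((0,T);H^1(D))$ with $\partial_tu\in L^2((0,T);H^1(D)^* )$. Problem 1: admissible data are $\xi=(\alpha,\beta,V,u^0)$ with $\alpha,\beta\in L^\infty((0,T)\times D)$ bounded below a.e. by positive constants $\alpha_0,\beta_0$, $V\in L^\infty((0,T);W^{1,\infty}(D))$, and $u^0\in W^{2-2/p,p}(D)$ ($2<p<3$ fixed), $0\le u^0\le1$. $\mathcal S_1(\xi)$ is the unique weak solution $u\in\Xi$ with $u(0)=u^0$ of $\partial_tu+\nabla\cdot(-\nabla u+f(u)\nabla V)=\alpha f(u)-\beta u$ in $(0,T)\times D$, $(-\nabla u+f(u)\nabla V)\cdot n=0$ on $(0,T)\times\partial D$, i.e. $\int_D\partial_tu\,\varphi\,dx-\int_D(-\nabla u+f(u)\nabla V)\cdot\nabla\varphi\,dx+\int_D\beta u\varphi\,dx-\int_D\alpha f(u)\varphi\,dx=0$ for all $\varphi\in H^1(D)$ and a.e. $t$. The metric is $d_1(\xi_1,\xi_2)=\|\alpha_1-\alpha_2\|_{L^\infty((0,T)\times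 D)}+\|\beta_1-\beta_2\|_{L^\infty((0,T)\times D)}+\|V_1-V_2\|_{L^\infty((0,T);W^{1,\infty}(D))}+\|u_1^0-u_2^0\|_{L^2(D)}$. Problem 2: admissible data are $\xi=(a,b,V,\underline u^0)$ with $a\in L^\infty((0,T)\times\Gamma_{\mathrm{in}})$, $a_0\le a\le1$ a.e., $b\in L^\infty((0,T)\times\Gamma_{\mathrm{out}})$, $b_0\le b\le1$ a.e. (for some $a_0,b_0>0$), $V\in L^2((0,T);W^{1,\infty}(D))$ with $\Delta V=0$, and $\underline u^0\in L^2(D)$, $0\le\underline u^0\le1$. $\mathcal S_2(\xi)$ is the unique weak solution $u\in\Xi$ with $u(0)=\underline u^0$ of $\partial_tu+\nabla\cdot J=0$ in $(0,T)\times D$, $J=-\nabla u+f(u)\nabla V$, with $-J\cdot n=a\,g(u)$ on $\Gamma_{\mathrm{in}}$, $J\cdot n=b\,u$ on $\Gamma_{\mathrm{out}}$, $J\cdot n=0$ on the rest of $\partial D$, i.e. $\int_D\partial_tu\,\varphi\,dx-\int_D(-\nabla u+f(u)\nabla V)\cdot\nabla\varphi\,dx+\int_{\Gamma_{\mathrm{out}}}bu\varphi\,d\sigma=\int_{\Gamma_{\mathrm{in}}}a\,g(u)\varphi\,d\sigma$ for all $\varphi\in H^1(D)$ and a.e. $t$. The metric is $d_2(\xi_1,\xi_2)=\|a_1-a_2\|_{L^\infty((0,T)\times\Gamma_{\mathrm{in}})}+\|b_1-b_2\|_{L^\infty((0,T)\times\Gamma_{\mathrm{out}})}+\|V_1-V_2\|_{L^2((0,T);W^{1,\infty}(D))}+\|\underline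 u_1^0-\underline u_2^0\|_{L^2(D)}$. Wasserstein distance: for probability measures $P,\tilde P$ on a Polish space $(X,d)$ and $r\ge1$, $d_r(P,\tilde P)^r=\inf_\pi\iint_{X\times X}d(\xi,\tilde\xi)^r\,\pi(d\xi,d\tilde\xi)$, the infimum being over all probability measures $\pi$ on $X\times X$ with marginals $P$ and $\tilde P$. $\mathbb{E}_P\Phi(\mathcal S_j)=\int\Phi(\mathcal S_j(\xi))\,P(d\xi)$; these expectations are assumed to be well defined and finite. *)

theory Defs
  imports "HOL-Analysis.Analysis" "HOL-Probability.Essential_Supremum"
    "HOL-Probability.Probability_Measure"
begin

(* Elements of Lebesgue, Sobolev and Bochner spaces are represented by functions; norms are
   insensitive to changes on null sets, and a.e. equality is made explicit where it matters. *)

section \<open>Lipschitz domains and surface measure\<close>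

(* Near each boundary point, D is the strict epigraph of a Lipschitz function over the
   hyperplane orthogonal to e; y - (y \<bullet> e) *R e is the orthogonal projection onto it. *)
definition lipschitz_domain :: "'a::euclidean_space set \<Rightarrow> bool" where
  "lipschitz_domain D \<longleftrightarrow> open D \<and> connected D \<and> bounded D \<and> D \<noteq> {} \<and>
     (\<forall>x\<in>frontier D. \<exists>e \<gamma> L r. norm e = 1 \<and> r > 0 \<and> L-lipschitz_on UNIV (\<gamma> :: 'a \<Rightarrow> real) \<and>
        (\<forall>y\<in>ball x r. y \<in> D \<longleftrightarrow> \<gamma> (y - (y \<bullet> e) *\<^sub>R e) < y \<bullet> e))"

(* Volume of a d-dimensional ball with the same diameter as U. The natural-number power
   gives 0 ^ 0 = 1, so for d = 0 one obtains counting measure. *)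
definition hausdorff_gauge :: "nat \<Rightarrow> 'a::metric_space set \<Rightarrow> ennreal" where
  "hausdorff_gauge d U =
     (if U = {} then 0 else ennreal (unit_ball_vol (real d) * (diameter U / 2) ^ d))"

definition hausdorff_outer :: "nat \<Rightarrow> 'a::metric_space set \<Rightarrow> ennreal" where
  "hausdorff_outer d A =
     (SUP \<delta>\<in>{0<..}. INF U\<in>{U :: nat \<Rightarrow> 'a set. A \<subseteq> (\<Union>i. U i) \<and>
                             (\<forall>i. bounded (U i) \<and> diameter (U i) \<le> \<delta>)}.
        (\<Sum>i. hausdorff_gauge d (U i)))"

definition hausdorff_measure :: "nat \<Rightarrow> 'a::metric_space measure" where
  "hausdorff_measure d = measure_of UNIV (sets borel) (hausdorff_outer d)"

definition surface_on :: "'a::euclidean_space set \<Rightarrow> 'a measure" where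
  "surface_on \<Gamma> = restrict_space (hausdorff_measure (DIM('a) - 1)) \<Gamma>"

section \<open>Lebesgue spaces\<close>

definition Lp :: "real \<Rightarrow> 'b measure \<Rightarrow> ('b \<Rightarrow> 'c::euclidean_space) set" where
  "Lp p M = {u \<in> borel_measurable M. integrable M (\<lambda>x. norm (u x) powr p)}"

definition Lp_norm :: "real \<Rightarrow> 'b measure \<Rightarrow> ('b \<Rightarrow> 'c::euclidean_space) \<Rightarrow> real" where
  "Lp_norm p M u = (LINT x|M. norm (u x) powr p) powr (1 / p)"

definition Linf :: "'b measure \<Rightarrow> ('b \<Rightarrow> 'c::euclidean_space) set" where
  "Linf M = {u \<in> borel_measurable M. \<exists>K. AE x in M. norm (u x) \<le> K}"

definition Linf_norm :: "'b measure \<Rightarrow> ('b \<Rightarrow> 'c::euclidean_space) \<Rightarrow> real" where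
  "Linf_norm M u = enn2real (esssup M (\<lambda>x. ennreal (norm (u x))))"

section \<open>Weak derivatives and Sobolev spaces\<close>

primrec Ck :: "nat \<Rightarrow> ('a::euclidean_space \<Rightarrow> real) \<Rightarrow> bool" where
  "Ck 0 \<phi> \<longleftrightarrow> continuous_on UNIV \<phi>"
| "Ck (Suc k) \<phi> \<longleftrightarrow> \<phi> differentiable_on UNIV \<and>
     (\<forall>v. Ck k (\<lambda>x. frechet_derivative \<phi> (at x) v))"

definition smooth :: "('a::euclidean_space \<Rightarrow> real) \<Rightarrow> bool" where
  "smooth \<phi> \<longleftrightarrow> (\<forall>k. Ck k \<phi>)"

definition test_function :: "'a::euclidean_space set \<Rightarrow> ('a \<Rightarrow> real) \<Rightarrow> bool" where
  "test_function D \<phi> \<longleftrightarrow>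
     smooth \<phi> \<and> compact (closure {x. \<phi> x \<noteq> 0}) \<and> closure {x. \<phi> x \<noteq> 0} \<subseteq> D"

definition grad :: "('a::euclidean_space \<Rightarrow> real) \<Rightarrow> 'a \<Rightarrow> 'a" where
  "grad \<phi> x = (\<Sum>b\<in>Basis. frechet_derivative \<phi> (at x) b *\<^sub>R b)"

definition is_weak_grad :: "'a::euclidean_space set \<Rightarrow> ('a \<Rightarrow> real) \<Rightarrow> ('a \<Rightarrow> 'a) \<Rightarrow> bool" where
  "is_weak_grad D u G \<longleftrightarrow>
     (\<forall>K\<subseteq>D. compact K \<longrightarrow> integrable (lebesgue_on K) u \<and> integrable (lebesgue_on K) G) \<and>
     (\<forall>\<phi>. test_function D \<phi> \<longrightarrow>
        (LINT x|lebesgue_on D. u x *\<^sub>R grad \<phi> x) = - (LINT x|lebesgue_on D. \<phi> x *\<^sub>R G x))"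

definition weak_grad :: "'a::euclidean_space set \<Rightarrow> ('a \<Rightarrow> real) \<Rightarrow> 'a \<Rightarrow> 'a" where
  "weak_grad D u = (SOME G. is_weak_grad D u G)"

definition W1p :: "'a::euclidean_space set \<Rightarrow> real \<Rightarrow> ('a \<Rightarrow> real) set" where
  "W1p D p = {u \<in> Lp p (lebesgue_on D). \<exists>G\<in>Lp p (lebesgue_on D). is_weak_grad D u G}"

definition W1inf :: "'a::euclidean_space set \<Rightarrow> ('a \<Rightarrow> real) set" where
  "W1inf D = {u \<in> Linf (lebesgue_on D). \<exists>G\<in>Linf (lebesgue_on D). is_weak_grad D u G}"

definition W1inf_norm :: "'a::euclidean_space set \<Rightarrow> ('a \<Rightarrow> real) \<Rightarrow> real" where
  "W1inf_norm D u = Linf_norm (lebesgue_on D) u + Linf_norm (lebesgue_on D) (weak_grad D u)"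

abbreviation H1 :: "'a::euclidean_space set \<Rightarrow> ('a \<Rightarrow> real) set" where
  "H1 D \<equiv> W1p D 2"

definition H1_norm :: "'a::euclidean_space set \<Rightarrow> ('a \<Rightarrow> real) \<Rightarrow> real" where
  "H1_norm D u = sqrt ((Lp_norm 2 (lebesgue_on D) u)\<^sup>2 + (Lp_norm 2 (lebesgue_on D) (weak_grad D u))\<^sup>2)"

(* Sobolev-Slobodeckij space for 1 < s < 2: the weak gradient has finite Gagliardo seminorm of
   order s - 1. *)
definition W_slobodeckij :: "'a::euclidean_space set \<Rightarrow> real \<Rightarrow> real \<Rightarrow> ('a \<Rightarrow> real) set" where
  "W_slobodeckij D s p = {u \<in> W1p D p.
     (\<integral>\<^sup>+ x. \<integral>\<^sup>+ y. ennreal (norm (weak_grad D u x - weak_grad D u y) powr p /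
          norm (x - y) powr (real DIM('a) + (s - 1) * p)) \<partial>lebesgue_on D \<partial>lebesgue_on D) < \<infinity>}"

definition is_trace :: "'a::euclidean_space set \<Rightarrow> ('a \<Rightarrow> real) \<Rightarrow> ('a \<Rightarrow> real) \<Rightarrow> bool" where
  "is_trace D u w \<longleftrightarrow> w \<in> Lp 2 (surface_on (frontier D)) \<and>
     (\<exists>\<phi> :: nat \<Rightarrow> 'a \<Rightarrow> real. (\<forall>k. smooth (\<phi> k)) \<and>
        (\<lambda>k. H1_norm D (\<phi> k - u)) \<longlonglongrightarrow> 0 \<and>
        (\<lambda>k. Lp_norm 2 (surface_on (frontier D)) (\<phi> k - w)) \<longlonglongrightarrow> 0)"

definition trace :: "'a::euclidean_space set \<Rightarrow> ('a \<Rightarrow> real) \<Rightarrow> 'a \<Rightarrow> real" where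
  "trace D u = (SOME w. is_trace D u w)"

section \<open>Bochner spaces\<close>

(* Functions of time with values in a function space V seminormed by nrm. Strong measurability:
   a.e. limit, with respect to nrm, of V-valued simple functions. *)
definition strongly_measurable ::
  "real measure \<Rightarrow> 'v::minus set \<Rightarrow> ('v \<Rightarrow> real) \<Rightarrow> (real \<Rightarrow> 'v) \<Rightarrow> bool" where
  "strongly_measurable M V nrm u \<longleftrightarrow>
     (\<exists>s. (\<forall>k. simple_function M (s k) \<and> s k ` space M \<subseteq> V) \<and>
          (AE t in M. (\<lambda>k::nat. nrm (s k t - u t)) \<longlonglongrightarrow> 0))"

definition L2_bochner ::
  "real measure \<Rightarrow> 'v::minus set \<Rightarrow> ('v \<Rightarrow> real) \<Rightarrow> (real \<Rightarrow> 'v) set" where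
  "L2_bochner M V nrm = {u. (AE t in M. u t \<in> V) \<and> strongly_measurable M V nrm u \<and>
     (\<lambda>t. nrm (u t)) \<in> Lp 2 M}"

definition Linf_bochner ::
  "real measure \<Rightarrow> 'v::minus set \<Rightarrow> ('v \<Rightarrow> real) \<Rightarrow> (real \<Rightarrow> 'v) set" where
  "Linf_bochner M V nrm = {u. (AE t in M. u t \<in> V) \<and> strongly_measurable M V nrm u \<and>
     (\<lambda>t. nrm (u t)) \<in> Linf M}"

abbreviation time_measure :: "real \<Rightarrow> real measure" where
  "time_measure T \<equiv> lebesgue_on {0<..<T}"

abbreviation spacetime_measure :: "real \<Rightarrow> 'a::euclidean_space set \<Rightarrow> (real \<times> 'a) measure" where
  "spacetime_measure T D \<equiv> lebesgue_on ({0<..<T} \<times> D)"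

abbreviation boundary_measure :: "real \<Rightarrow> 'a::euclidean_space set \<Rightarrow> (real \<times> 'a) measure" where
  "boundary_measure T \<Gamma> \<equiv> time_measure T \<Otimes>\<^sub>M surface_on \<Gamma>"

definition L2H1_norm :: "real \<Rightarrow> 'a::euclidean_space set \<Rightarrow> (real \<Rightarrow> 'a \<Rightarrow> real) \<Rightarrow> real" where
  "L2H1_norm T D u = Lp_norm 2 (time_measure T) (\<lambda>t. H1_norm D (u t))"

definition H1_dual :: "'a::euclidean_space set \<Rightarrow> (('a \<Rightarrow> real) \<Rightarrow> real) set" where
  "H1_dual D = {F.
     (\<forall>\<phi>\<in>H1 D. \<forall>\<psi>\<in>H1 D. \<forall>c d. F (\<lambda>x. c * \<phi> x + d * \<psi> x) = c * F \<phi> + d * F \<psi>) \<and>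
     (\<exists>K. \<forall>\<phi>\<in>H1 D. \<bar>F \<phi>\<bar> \<le> K * H1_norm D \<phi>)}"

definition H1_dual_norm :: "'a::euclidean_space set \<Rightarrow> (('a \<Rightarrow> real) \<Rightarrow> real) \<Rightarrow> real" where
  "H1_dual_norm D F = (SUP \<phi>\<in>{\<phi> \<in> H1 D. H1_norm D \<phi> \<le> 1}. \<bar>F \<phi>\<bar>)"

(* Distributional time derivative in the Gelfand triple H1 < L2 < H1*. *)
definition is_time_deriv :: "real \<Rightarrow> 'a::euclidean_space set \<Rightarrow>
    (real \<Rightarrow> 'a \<Rightarrow> real) \<Rightarrow> (real \<Rightarrow> ('a \<Rightarrow> real) \<Rightarrow> real) \<Rightarrow> bool" where
  "is_time_deriv T D u w \<longleftrightarrow>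
     w \<in> L2_bochner (time_measure T) (H1_dual D) (H1_dual_norm D) \<and>
     (\<forall>\<phi>\<in>H1 D. \<forall>\<psi>. test_function {0<..<T} \<psi> \<longrightarrow>
        (LINT t|time_measure T. deriv \<psi> t * (LINT x|lebesgue_on D. u t x * \<phi> x)) =
        - (LINT t|time_measure T. \<psi> t * w t \<phi>))"

definition Xi :: "real \<Rightarrow> 'a::euclidean_space set \<Rightarrow> (real \<Rightarrow> 'a \<Rightarrow> real) set" where
  "Xi T D = {u \<in> L2_bochner (time_measure T) (H1 D) (H1_norm D). \<exists>w. is_time_deriv T D u w}"

(* u(0) = u0 for the representative v of u that is continuous on [0,T] with values in L2(D). *)
definition initial_value ::
  "real \<Rightarrow> 'a::euclidean_space set \<Rightarrow> (real \<Rightarrow> 'a \<Rightarrow> real) \<Rightarrow> ('a \<Rightarrow> real) \<Rightarrow> bool" where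
  "initial_value T D u u0 \<longleftrightarrow>
     (\<exists>v. (\<forall>t\<in>{0..T}. v t \<in> Lp 2 (lebesgue_on D) \<and>
             ((\<lambda>s. Lp_norm 2 (lebesgue_on D) (v s - v t)) \<longlongrightarrow> 0) (at t within {0..T})) \<and>
          (AE t in time_measure T. AE x in lebesgue_on D. v t x = u t x) \<and>
          (AE x in lebesgue_on D. v 0 x = u0 x))"

section \<open>The two problems\<close>

(* Data are quadruples (\<alpha>, \<beta>, V, u0) for Problem 1 and (a, b, V, u0) for Problem 2. *)
type_synonym 'a data =
  "(real \<times> 'a \<Rightarrow> real) \<times> (real \<times> 'a \<Rightarrow> real) \<times> (real \<Rightarrow> 'a \<Rightarrow> real) \<times> ('a \<Rightarrow> real)"

definition admissible1 :: "real \<Rightarrow> 'a::euclidean_space set \<Rightarrow> real \<Rightarrow> 'a data set" where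
  "admissible1 T D p = {(\<alpha>, \<beta>, V, u0).
     \<alpha> \<in> Linf (spacetime_measure T D) \<and> (\<exists>\<alpha>0>0. AE z in spacetime_measure T D. \<alpha>0 \<le> \<alpha> z) \<and>
     \<beta> \<in> Linf (spacetime_measure T D) \<and> (\<exists>\<beta>0>0. AE z in spacetime_measure T D. \<beta>0 \<le> \<beta> z) \<and>
     V \<in> Linf_bochner (time_measure T) (W1inf D) (W1inf_norm D) \<and>
     u0 \<in> W_slobodeckij D (2 - 2 / p) p \<and>
     (AE x in lebesgue_on D. 0 \<le> u0 x \<and> u0 x \<le> 1)}"

definition weak_solution1 :: "real \<Rightarrow> 'a::euclidean_space set \<Rightarrow> (real \<Rightarrow> real) \<Rightarrow>
    'a data \<Rightarrow> (real \<Rightarrow> 'a \<Rightarrow> real) \<Rightarrow> bool" where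
  "weak_solution1 T D f = (\<lambda>(\<alpha>, \<beta>, V, u0) u.
     u \<in> Xi T D \<and> initial_value T D u u0 \<and>
     (\<exists>w. is_time_deriv T D u w \<and> (\<forall>\<phi>\<in>H1 D. AE t in time_measure T.
        w t \<phi>
        - (LINT x|lebesgue_on D.
             (- weak_grad D (u t) x + f (u t x) *\<^sub>R weak_grad D (V t) x) \<bullet> weak_grad D \<phi> x)
        + (LINT x|lebesgue_on D. \<beta> (t, x) * u t x * \<phi> x)
        - (LINT x|lebesgue_on D. \<alpha> (t, x) * f (u t x) * \<phi> x) = 0)))"

definition dist1 :: "real \<Rightarrow> 'a::euclidean_space set \<Rightarrow> 'a data \<Rightarrow> 'a data \<Rightarrow> real" where
  "dist1 T D = (\<lambda>(\<alpha>1, \<beta>1, V1, u1) (\<alpha>2, \<beta>2, V2, u2).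
     Linf_norm (spacetime_measure T D) (\<alpha>1 - \<alpha>2) +
     Linf_norm (spacetime_measure T D) (\<beta>1 - \<beta>2) +
     Linf_norm (time_measure T) (\<lambda>t. W1inf_norm D (V1 t - V2 t)) +
     Lp_norm 2 (lebesgue_on D) (u1 - u2))"

definition admissible2 :: "real \<Rightarrow> 'a::euclidean_space set \<Rightarrow> 'a set \<Rightarrow> 'a set \<Rightarrow> 'a data set" where
  "admissible2 T D \<Gamma>in \<Gamma>out = {(a, b, V, u0).
     a \<in> Linf (boundary_measure T \<Gamma>in) \<and>
     (\<exists>a0>0. AE z in boundary_measure T \<Gamma>in. a0 \<le> a z \<and> a z \<le> 1) \<and>
     b \<in> Linf (boundary_measure T \<Gamma>out) \<and>
     (\<exists>b0>0. AE z in boundary_measure T \<Gamma>out. b0 \<le> b z \<and> b z \<le> 1) \<and>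
     V \<in> L2_bochner (time_measure T) (W1inf D) (W1inf_norm D) \<and>
     (AE t in time_measure T. \<forall>\<phi>. test_function D \<phi> \<longrightarrow>
        (LINT x|lebesgue_on D. weak_grad D (V t) x \<bullet> grad \<phi> x) = 0) \<and>
     u0 \<in> Lp 2 (lebesgue_on D) \<and>
     (AE x in lebesgue_on D. 0 \<le> u0 x \<and> u0 x \<le> 1)}"

definition weak_solution2 :: "real \<Rightarrow> 'a::euclidean_space set \<Rightarrow> (real \<Rightarrow> real) \<Rightarrow> (real \<Rightarrow> real) \<Rightarrow>
    'a set \<Rightarrow> 'a set \<Rightarrow> 'a data \<Rightarrow> (real \<Rightarrow> 'a \<Rightarrow> real) \<Rightarrow> bool" where
  "weak_solution2 T D f g \<Gamma>in \<Gamma>out = (\<lambda>(a, b, V, u0) u.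
     u \<in> Xi T D \<and> initial_value T D u u0 \<and>
     (\<exists>w. is_time_deriv T D u w \<and> (\<forall>\<phi>\<in>H1 D. AE t in time_measure T.
        w t \<phi>
        - (LINT x|lebesgue_on D.
             (- weak_grad D (u t) x + f (u t x) *\<^sub>R weak_grad D (V t) x) \<bullet> weak_grad D \<phi> x)
        + (LINT x|surface_on \<Gamma>out. b (t, x) * trace D (u t) x * trace D \<phi> x)
        = (LINT x|surface_on \<Gamma>in. a (t, x) * g (trace D (u t) x) * trace D \<phi> x))))"

definition dist2 :: "real \<Rightarrow> 'a::euclidean_space set \<Rightarrow> 'a set \<Rightarrow> 'a set \<Rightarrow> 'a data \<Rightarrow> 'a data \<Rightarrow> real" where
  "dist2 T D \<Gamma>in \<Gamma>out = (\<lambda>(a1, b1, V1, u1) (a2, b2, V2, u2).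
     Linf_norm (boundary_measure T \<Gamma>in) (a1 - a2) +
     Linf_norm (boundary_measure T \<Gamma>out) (b1 - b2) +
     Lp_norm 2 (time_measure T) (\<lambda>t. W1inf_norm D (V1 t - V2 t)) +
     Lp_norm 2 (lebesgue_on D) (u1 - u2))"

definition ae_equal1 :: "real \<Rightarrow> 'a::euclidean_space set \<Rightarrow> 'a data \<Rightarrow> 'a data \<Rightarrow> bool" where
  "ae_equal1 T D = (\<lambda>(\<alpha>1, \<beta>1, V1, u1) (\<alpha>2, \<beta>2, V2, u2).
     (AE z in spacetime_measure T D. \<alpha>1 z = \<alpha>2 z) \<and>
     (AE z in spacetime_measure T D. \<beta>1 z = \<beta>2 z) \<and>
     (AE t in time_measure T. AE x in lebesgue_on D. V1 t x = V2 t x) \<and>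
     (AE x in lebesgue_on D. u1 x = u2 x))"

definition ae_equal2 ::
  "real \<Rightarrow> 'a::euclidean_space set \<Rightarrow> 'a set \<Rightarrow> 'a set \<Rightarrow> 'a data \<Rightarrow> 'a data \<Rightarrow> bool" where
  "ae_equal2 T D \<Gamma>in \<Gamma>out = (\<lambda>(a1, b1, V1, u1) (a2, b2, V2, u2).
     (AE z in boundary_measure T \<Gamma>in. a1 z = a2 z) \<and>
     (AE z in boundary_measure T \<Gamma>out. b1 z = b2 z) \<and>
     (AE t in time_measure T. AE x in lebesgue_on D. V1 t x = V2 t x) \<and>
     (AE x in lebesgue_on D. u1 x = u2 x))"

(* The data spaces proper: classes of admissible quadruples modulo a.e. equality, so that dist1
   and dist2, which are only pseudometrics on functions, become metrics. *)
definition data_space1 :: "real \<Rightarrow> 'a::euclidean_space set \<Rightarrow> real \<Rightarrow> 'a data set set" where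
  "data_space1 T D p = admissible1 T D p //
     {(\<xi>, \<eta>). \<xi> \<in> admissible1 T D p \<and> \<eta> \<in> admissible1 T D p \<and> ae_equal1 T D \<xi> \<eta>}"

definition data_space2 ::
  "real \<Rightarrow> 'a::euclidean_space set \<Rightarrow> 'a set \<Rightarrow> 'a set \<Rightarrow> 'a data set set" where
  "data_space2 T D \<Gamma>in \<Gamma>out = admissible2 T D \<Gamma>in \<Gamma>out //
     {(\<xi>, \<eta>). \<xi> \<in> admissible2 T D \<Gamma>in \<Gamma>out \<and> \<eta> \<in> admissible2 T D \<Gamma>in \<Gamma>out \<and>
              ae_equal2 T D \<Gamma>in \<Gamma>out \<xi> \<eta>}"

definition class_dist :: "('b \<Rightarrow> 'b \<Rightarrow> real) \<Rightarrow> 'b set \<Rightarrow> 'b set \<Rightarrow> real" where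
  "class_dist d A B = d (SOME \<xi>. \<xi> \<in> A) (SOME \<eta>. \<eta> \<in> B)"

(* S maps each class of data to the weak solution, which is unique up to a.e. equality. *)
definition solution_operator :: "real \<Rightarrow> 'a::euclidean_space set \<Rightarrow>
    ('a data \<Rightarrow> (real \<Rightarrow> 'a \<Rightarrow> real) \<Rightarrow> bool) \<Rightarrow> 'a data set set \<Rightarrow>
    ('a data set \<Rightarrow> real \<Rightarrow> 'a \<Rightarrow> real) \<Rightarrow> bool" where
  "solution_operator T D sol X S \<longleftrightarrow> (\<forall>A\<in>X. \<forall>\<xi>\<in>A. sol \<xi> (S A) \<and>
     (\<forall>v. sol \<xi> v \<longrightarrow> (AE t in time_measure T. AE x in lebesgue_on D. v t x = S A t x)))"

section \<open>Borel probability measures and Wasserstein distance\<close>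

definition polish_metric :: "'b set \<Rightarrow> ('b \<Rightarrow> 'b \<Rightarrow> real) \<Rightarrow> bool" where
  "polish_metric X d \<longleftrightarrow> Metric_space X d \<and>
     completely_metrizable_space (Metric_space.mtopology X d) \<and>
     separable_space (Metric_space.mtopology X d)"

definition borel_prob :: "'b set \<Rightarrow> ('b \<Rightarrow> 'b \<Rightarrow> real) \<Rightarrow> 'b measure \<Rightarrow> bool" where
  "borel_prob X d P \<longleftrightarrow> prob_space P \<and>
     space P = X \<and> sets P = sigma_sets X {U. openin (Metric_space.mtopology X d) U}"

(* On a Polish space the Borel sets of the product are the product sigma-algebra. *)
definition couplings :: "'b measure \<Rightarrow> 'b measure \<Rightarrow> ('b \<times> 'b) measure set" where
  "couplings P Q = {\<pi>. prob_space \<pi> \<and> sets \<pi> = sets (P \<Otimes>\<^sub>M Q) \<and> distr \<pi> P fst = P \<and> distr \<pi> Q snd = Q}"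

definition ennreal_powr :: "ennreal \<Rightarrow> real \<Rightarrow> ennreal" where
  "ennreal_powr x a = (if x = \<infinity> then \<infinity> else ennreal (enn2real x powr a))"

(* Possibly infinite, as no finiteness of moments is assumed. *)
definition wasserstein :: "('b \<Rightarrow> 'b \<Rightarrow> real) \<Rightarrow> real \<Rightarrow> 'b measure \<Rightarrow> 'b measure \<Rightarrow> ennreal" where
  "wasserstein d r P Q =
     ennreal_powr (INF \<pi>\<in>couplings P Q. \<integral>\<^sup>+ z. ennreal (d (fst z) (snd z) powr r) \<partial>\<pi>) (1 / r)"

end

theory Submission
  imports Defs
begin

(* Integrating F o fst - F o snd over a coupling of P and Q gives the difference of the two
   expectations, for every K-Lipschitz F. Jensen's inequality bounds its r-th power by
   K^r times the transport cost, and one takes the infimum over all couplings. The theorem is the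
   case F = \<Phi> o S, which is Lipschitz on X as a composition of Lipschitz maps. *)

text \<open>Convexity of t powr \<open>r\<close> on the open half-line puts its graph above the
  tangent at \<open>m\<close>. The endpoint \<open>x\<close> = 0 lies outside that set and is done
  by hand: there the tangent takes the value (1 - \<open>r\<close>) * \<open>m\<close> powr
  \<open>r\<close>, which is at most 0 = 0 powr \<open>r\<close>.\<close>

lemma powr_above_tangent:
  fixes x m r :: real
  assumes "x \<ge> 0" "m > 0" "r \<ge> 1"
  shows "m powr r + r * m powr (r - 1) * (x - m) \<le> x powr r"
proof (cases "x = 0")
  case True
  have "m powr (r - 1) * m = m powr r"
    using assms by (simp add: powr_diff)
  then have "m powr r + r * m powr (r - 1) * (x - m) = (1 - r) * m powr r"
    using True by (simp add: algebra_simps)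
  also have "\<dots> \<le> 0"
    using assms by (simp add: mult_nonpos_nonneg)
  finally show ?thesis
    using True by simp
next
  case False
  have "((\<lambda>t. t powr r) has_real_derivative r * m powr (r - 1)) (at m within {0<..})"
    using has_field_derivative_at_within[OF has_real_derivative_powr[OF \<open>m > 0\<close>]] .
  then have "r * m powr (r - 1) * (x - m) \<le> x powr r - m powr r"
    using assms False
    by (intro convex_on_imp_above_tangent[OF powr_convex[OF \<open>r \<ge> 1\<close>]])
       (auto simp: interior_open)
  then show ?thesis
    by simp
qed

text \<open>Jensen's inequality, by integrating the tangent inequality based at the mean of
  \<open>h\<close>. The right side is a nonnegative integral because the \<open>r\<close>-th moment
  of \<open>h\<close> may be infinite.\<close>

lemma (in prob_space) expectation_powr_le_nn_integral:
  fixes h :: "'a \<Rightarrow> real"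
  assumes h: "integrable M h" "\<And>x. h x \<ge> 0" and r: "r \<ge> 1"
  shows "ennreal (expectation h powr r) \<le> (\<integral>\<^sup>+ x. ennreal (h x powr r) \<partial>M)"
\<comment> \<open>The tangent needs a positive base point, and its comparison with
  \<open>h x powr r\<close> under the integral needs a finite moment. Otherwise the left side is 0
  powr \<open>r\<close> = 0 or the right side is infinite.\<close>
proof (cases "expectation h > 0 \<and> (\<integral>\<^sup>+ x. ennreal (h x powr r) \<partial>M) < \<infinity>")
  case True
  let ?m = "expectation h"
  have int: "integrable M (\<lambda>x. h x powr r)"
    using True h(1) by (intro integrableI_nonneg) auto
  \<comment> \<open>The linear term has mean zero because the base point is the mean, and the
    constant survives because the total mass is 1.\<close>
  have "?m powr r = expectation (\<lambda>x. ?m powr r + r * ?m powr (r - 1) * (h x - ?m))"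
    using h(1) by (simp add: prob_space)
  also have "\<dots> \<le> expectation (\<lambda>x. h x powr r)"
    using h int True r by (intro integral_mono powr_above_tangent) auto
  finally show ?thesis
    using nn_integral_eq_integral[OF int] by (simp add: ennreal_leI)
next
  case False
  moreover have "expectation h \<ge> 0"
    using h by simp
  ultimately consider "expectation h = 0" | "(\<integral>\<^sup>+ x. ennreal (h x powr r) \<partial>M) = \<infinity>"
    by (auto simp: order_le_less simp flip: less_top)
  then show ?thesis
    by cases auto
qed

text \<open>Change of variables along the two projections: they push \<open>\<pi>\<close> forward to
  \<open>P\<close> and \<open>Q\<close>, so integrability and integrals of \<open>F\<close> carry
  over from the marginals.\<close>

lemma coupling_expectation_diff:
  fixes F :: "'b \<Rightarrow> real"
  assumes \<pi>: "\<pi> \<in> couplings P Q" and F: "integrable P F" "integrable Q F"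
  shows "integrable \<pi> (\<lambda>z. F (fst z) - F (snd z))"
    and "(LINT z|\<pi>. F (fst z) - F (snd z)) = (LINT \<xi>|P. F \<xi>) - (LINT \<xi>|Q. F \<xi>)"
proof -
  have sets: "sets \<pi> = sets (P \<Otimes>\<^sub>M Q)" and dP: "distr \<pi> P fst = P" and dQ: "distr \<pi> Q snd = Q"
    using \<pi> by (auto simp: couplings_def)
  have mP: "fst \<in> \<pi> \<rightarrow>\<^sub>M P" and mQ: "snd \<in> \<pi> \<rightarrow>\<^sub>M Q"
    unfolding measurable_cong_sets[OF sets refl] by (rule measurable_fst, rule measurable_snd)
  have iP: "integrable \<pi> (\<lambda>z. F (fst z))"
    using integrable_distr[OF mP, of F] F(1) dP by simp
  have iQ: "integrable \<pi> (\<lambda>z. F (snd z))"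
    using integrable_distr[OF mQ, of F] F(2) dQ by simp
  show "integrable \<pi> (\<lambda>z. F (fst z) - F (snd z))"
    using iP iQ by simp
  have "(LINT z|\<pi>. F (fst z)) = (LINT \<xi>|P. F \<xi>)"
    using integral_distr[OF mP, of F] F(1) dP by simp
  moreover have "(LINT z|\<pi>. F (snd z)) = (LINT \<xi>|Q. F \<xi>)"
    using integral_distr[OF mQ, of F] F(2) dQ by simp
  ultimately show "(LINT z|\<pi>. F (fst z) - F (snd z)) = (LINT \<xi>|P. F \<xi>) - (LINT \<xi>|Q. F \<xi>)"
    using iP iQ by simp
qed

text \<open>Jensen's inequality for \<open>\<bar>F (fst z) - F (snd z)\<bar> / K\<close>, which is
  at most the distance of the two components. With \<open>K\<close> moved to the left, that side is
  the same for all couplings, so the bound passes to the infimum.\<close>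

lemma coupling_cost_lower_bound:
  fixes F :: "'b \<Rightarrow> real"
  assumes \<pi>: "\<pi> \<in> couplings P Q" and space: "space P = X" "space Q = X"
    and F: "integrable P F" "integrable Q F"
    and lip: "\<And>\<xi> \<eta>. \<xi> \<in> X \<Longrightarrow> \<eta> \<in> X \<Longrightarrow> \<bar>F \<xi> - F \<eta>\<bar> \<le> K * d \<xi> \<eta>"
    and K: "K > 0" and r: "r \<ge> 1"
  shows "ennreal ((\<bar>(LINT \<xi>|P. F \<xi>) - (LINT \<xi>|Q. F \<xi>)\<bar> / K) powr r)
    \<le> (\<integral>\<^sup>+ z. ennreal (d (fst z) (snd z) powr r) \<partial>\<pi>)"
proof -
  interpret prob_space \<pi>
    using \<pi> by (simp add: couplings_def)
  \<comment> \<open>\<open>lip\<close> speaks only of points of \<open>X\<close>, so both components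
    of \<open>z\<close> must be known to lie there.\<close>
  have sp: "space \<pi> = X \<times> X"
    using \<pi> space sets_eq_imp_space_eq[of \<pi> "P \<Otimes>\<^sub>M Q"]
    by (simp add: couplings_def space_pair_measure)
  note diff = coupling_expectation_diff[OF \<pi> F]
  define h where "h = (\<lambda>z. \<bar>F (fst z) - F (snd z)\<bar> / K)"
  have h: "integrable \<pi> h" "\<And>z. h z \<ge> 0"
    using diff(1) K by (auto simp: h_def)
  have "\<bar>(LINT \<xi>|P. F \<xi>) - (LINT \<xi>|Q. F \<xi>)\<bar> / K \<le> expectation h"
    using integral_abs_bound[of \<pi> "\<lambda>z. F (fst z) - F (snd z)"] K
    by (simp add: h_def diff(2) divide_right_mono)
  then have "ennreal ((\<bar>(LINT \<xi>|P. F \<xi>) - (LINT \<xi>|Q. F \<xi>)\<bar> / K) powr r)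
      \<le> ennreal (expectation h powr r)"
    using K r by (intro ennreal_leI powr_mono2) auto
  also have "\<dots> \<le> (\<integral>\<^sup>+ z. ennreal (h z powr r) \<partial>\<pi>)"
    by (rule expectation_powr_le_nn_integral[OF h r])
  also have "\<dots> \<le> (\<integral>\<^sup>+ z. ennreal (d (fst z) (snd z) powr r) \<partial>\<pi>)"
  proof (intro nn_integral_mono ennreal_leI powr_mono2)
    fix z assume "z \<in> space \<pi>"
    then show "h z \<le> d (fst z) (snd z)"
      using lip[of "fst z" "snd z"] K
      by (auto simp: sp h_def pos_divide_le_eq mult.commute)
  qed (use h r in auto)
  finally show ?thesis .
qed

lemma expectation_diff_le_wasserstein:
  fixes F :: "'b \<Rightarrow> real"
  assumes P: "prob_space P" "space P = X" "integrable P F"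
    and Q: "prob_space Q" "space Q = X" "integrable Q F"
    and lip: "\<And>\<xi> \<eta>. \<xi> \<in> X \<Longrightarrow> \<eta> \<in> X \<Longrightarrow> \<bar>F \<xi> - F \<eta>\<bar> \<le> K * d \<xi> \<eta>"
    and K: "K \<ge> 0" and r: "r \<ge> 1"
  shows "ennreal \<bar>(LINT \<xi>|P. F \<xi>) - (LINT \<xi>|Q. F \<xi>)\<bar> \<le> ennreal K * wasserstein d r P Q"
\<comment> \<open>Division by \<open>K\<close> is impossible here. As 0 * \<infinity> = 0 in
  \<open>ennreal\<close>, the right side vanishes even for infinite Wasserstein distance, so the two
  expectations must coincide. They do: \<open>F\<close> is constant on \<open>X\<close>, and both
  measures have mass 1.\<close>
proof (cases "K = 0")
  case True
  obtain \<xi>0 where \<xi>0: "\<xi>0 \<in> X"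
    using prob_space.not_empty[OF P(1)] P(2) by auto
  have "F \<xi> = F \<xi>0" if "\<xi> \<in> X" for \<xi>
    using lip[OF that \<xi>0] True by simp
  then have "(LINT \<xi>|P. F \<xi>) = (LINT \<xi>|P. F \<xi>0)" "(LINT \<xi>|Q. F \<xi>) = (LINT \<xi>|Q. F \<xi>0)"
    using P(2) Q(2) by (auto intro!: Bochner_Integration.integral_cong simp del: lebesgue_integral_const)
  then show ?thesis
    using prob_space.prob_space[OF P(1)] prob_space.prob_space[OF Q(1)] by simp
next
  case False
  define A where "A = \<bar>(LINT \<xi>|P. F \<xi>) - (LINT \<xi>|Q. F \<xi>)\<bar>"
  define I where "I = (INF \<pi>\<in>couplings P Q. \<integral>\<^sup>+ z. ennreal (d (fst z) (snd z) powr r) \<partial>\<pi>)"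
  have K': "K > 0" and A: "A \<ge> 0"
    using False K by (auto simp: A_def)
  have le: "ennreal ((A / K) powr r) \<le> I"
    unfolding I_def A_def
    by (rule INF_greatest, rule coupling_cost_lower_bound[OF _ P(2) Q(2) P(3) Q(3) lip K' r])
  show ?thesis
  \<comment> \<open>An infinite infimum makes the right side infinite, since \<open>K\<close> is
    positive. A finite one allows taking the \<open>r\<close>-th root in the reals, where
    \<open>ennreal_powr\<close> is the ordinary power.\<close>
  proof (cases "I = \<infinity>")
    case True
    then show ?thesis
      using K' by (simp add: wasserstein_def I_def[symmetric] ennreal_powr_def ennreal_mult_top)
  next
    case False
    then have "(A / K) powr r \<le> enn2real I"
      using enn2real_mono[OF le] by (simp add: less_top)
    then have "((A / K) powr r) powr (1 / r) \<le> enn2real I powr (1 / r)"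
      using r by (intro powr_mono2) auto
    then have "A \<le> K * enn2real I powr (1 / r)"
      using r K' A by (simp add: powr_powr pos_divide_le_eq mult.commute)
    then show ?thesis
      using K False
      by (simp add: wasserstein_def I_def[symmetric] A_def[symmetric] ennreal_powr_def
          ennreal_leI flip: ennreal_mult)
  qed
qed

theorem theorem5p2:
  fixes D \<Gamma>in \<Gamma>out :: "'a::euclidean_space set"
    and T p C C' L r :: real
    and f g :: "real \<Rightarrow> real"
    and j :: nat
    and dat :: "'a data set set"
    and d :: "'a data set \<Rightarrow> 'a data set \<Rightarrow> real"
    and sol :: "'a data \<Rightarrow> (real \<Rightarrow> 'a \<Rightarrow> real) \<Rightarrow> bool"
    and X :: "'a data set set"
    and S :: "'a data set \<Rightarrow> real \<Rightarrow> 'a \<Rightarrow> real"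
    and \<Phi> :: "(real \<Rightarrow> 'a \<Rightarrow> real) \<Rightarrow> real"
    and P Q :: "'a data set measure"
  assumes dim: "DIM('a) \<in> {1, 2, 3}"
    and dom: "lipschitz_domain D"
    and T: "T > 0"
    and p: "2 < p" "p < 3"
    and f: "continuous_on UNIV f" "f \<in> W1inf UNIV" "f 0 = 0" "f 1 = 0" "\<forall>s\<in>{0<..<1}. f s \<ge> 0"
    and g: "continuous_on UNIV g" "g \<in> W1inf UNIV" "antimono g" "g 0 = 1" "g 1 = 0"
    and Gamma: "openin (top_of_set (frontier D)) \<Gamma>in" "openin (top_of_set (frontier D)) \<Gamma>out"
      "\<Gamma>in \<inter> \<Gamma>out = {}" "\<Gamma>out \<noteq> {}"
    and problem:
      "j = 1 \<and> dat = data_space1 T D p \<and> d = class_dist (dist1 T D) \<and>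
         sol = weak_solution1 T D f \<or>
       j = 2 \<and> dat = data_space2 T D \<Gamma>in \<Gamma>out \<and> d = class_dist (dist2 T D \<Gamma>in \<Gamma>out) \<and>
         sol = weak_solution2 T D f g \<Gamma>in \<Gamma>out"
    and X: "X \<subseteq> dat" "polish_metric X d"
    and S: "S \<in> X \<rightarrow> Xi T D" "solution_operator T D sol X S"
    and C: "C > 0" "C' > 0"
    and lipschitz_S: "\<forall>\<xi>\<in>X. \<forall>\<eta>\<in>X. L2H1_norm T D (S \<xi> - S \<eta>) \<le> C * exp (C' * T / 2) * d \<xi> \<eta>"
    and L: "L \<ge> 0"
    and lipschitz_Phi: "\<forall>u\<in>Xi T D. \<forall>v\<in>Xi T D. \<bar>\<Phi> u - \<Phi> v\<bar> \<le> L * L2H1_norm T D (u - v)"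
    and P: "borel_prob X d P" "integrable P (\<lambda>\<xi>. \<Phi> (S \<xi>))"
    and Q: "borel_prob X d Q" "integrable Q (\<lambda>\<xi>. \<Phi> (S \<xi>))"
    and r: "r \<ge> 1"
  shows "ennreal \<bar>(LINT \<xi>|P. \<Phi> (S \<xi>)) - (LINT \<xi>|Q. \<Phi> (S \<xi>))\<bar>
     \<le> ennreal (L * C * exp (C' * T / 2)) * wasserstein d r P Q"
proof (rule expectation_diff_le_wasserstein[where X = X])
  \<comment> \<open>The Lipschitz constants of \<open>\<Phi>\<close> and \<open>S\<close> multiply
    to the \<open>K\<close> of the general bound. It is 0 when \<open>L\<close> = 0, which is why
    that bound admits \<open>K\<close> = 0.\<close>
  show "\<bar>\<Phi> (S \<xi>) - \<Phi> (S \<eta>)\<bar> \<le> L * C * exp (C' * T / 2) * d \<xi> \<eta>"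
    if "\<xi> \<in> X" "\<eta> \<in> X" for \<xi> \<eta>
  proof -
    have "\<bar>\<Phi> (S \<xi>) - \<Phi> (S \<eta>)\<bar> \<le> L * L2H1_norm T D (S \<xi> - S \<eta>)"
      using lipschitz_Phi S(1) that by auto
    also have "\<dots> \<le> L * (C * exp (C' * T / 2) * d \<xi> \<eta>)"
      using lipschitz_S that L by (intro mult_left_mono) auto
    finally show ?thesis
      by (simp add: mult.assoc)
  qed
qed (use P Q C L r in \<open>simp_all add: borel_prob_def\<close>)

end
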